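(* Let $G_1=(V,E_1)$ and $G_2=(V,E_2)$ be two graphs on the same vertex set $V$ with $|V|=m$ and $E_1\cap E_2=\emptyset$, and let $\ell\ge 2$ be a given integer. Let $\delta_1$ be the minimum degree of $G_1$ and $\Delta_2$ the maximum degree of $G_2$. Suppose that $$m\left(\frac{\ell^2-1}{\ell^2}+\alpha\right)\le \delta_1 \quad\text{where } 0<\alpha<\frac{1}{\ell^2},$$ and $$\Delta_2\le \sqrt{\frac{m\alpha-\ell}{3}}.$$ If $m\ge m(\ell)$ is large enough, then there are $\lfloor m/\ell\rfloor$ vertex-disjoint copies of $K_\ell$ in $G_1$ such that no two of these copies span an alternating-$(\ell,2,\ell,2)$-bag.
   Context: Edges of $G_1$ are called blue and edges of $G_2$ red. An alternating-$(\ell,2,\ell,2)$-bag consists of two vertex-disjoint copies of $K_\ell$ in $G_1$ (all edges blue) together with two vertex-disjoint edges of $G_2$ (red edges), each of which connects a vertex of one of the two copies with a vertex of the other copy. Two vertex-disjoint copies of $K_\ell$ in $G_1$ span an alternating-$(\ell,2,\ell,2)$-bag if there are two vertex-disjoint red edges each joining a vertex of one copy to a vertex of the other copy. *)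

theory Defs
  imports Complex_Main "HOL-Library.Ramsey" "HOL-Library.Disjoint_Sets"
begin

definition fin_graph :: "'a set \<Rightarrow> 'a set set \<Rightarrow> bool" where
  "fin_graph V E \<longleftrightarrow> finite V \<and> E \<subseteq> [V]\<^bsup>2\<^esup>"

definition vertex_degree :: "'a set set \<Rightarrow> 'a \<Rightarrow> nat" where
  "vertex_degree E v = card {e \<in> E. v \<in> e}"

(* Only meaningful for nonempty V. *)
definition min_degree :: "'a set \<Rightarrow> 'a set set \<Rightarrow> nat" where
  "min_degree V E = Min (vertex_degree E ` V)"

definition max_degree :: "'a set \<Rightarrow> 'a set set \<Rightarrow> nat" where
  "max_degree V E = Max (vertex_degree E ` V)"

(* A copy of the complete graph on l vertices is identified with its vertex set. *)
definition complete_copy :: "nat \<Rightarrow> 'a set \<Rightarrow> 'a set set \<Rightarrow> 'a set \<Rightarrow> bool" where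
  "complete_copy l V E A \<longleftrightarrow> A \<in> [V]\<^bsup>l\<^esup> \<and> clique A E"

(* e and f are the two red (E2) edges of the bag; A and B its two blue (E1) cliques. *)
definition alternating_bag ::
  "nat \<Rightarrow> 'a set \<Rightarrow> 'a set set \<Rightarrow> 'a set set \<Rightarrow> 'a set \<Rightarrow> 'a set \<Rightarrow> 'a set \<Rightarrow> 'a set \<Rightarrow> bool" where
  "alternating_bag l V E1 E2 A B e f \<longleftrightarrow>
     complete_copy l V E1 A \<and> complete_copy l V E1 B \<and> A \<inter> B = {} \<and>
     e \<in> E2 \<and> f \<in> E2 \<and> e \<inter> f = {} \<and>
     (\<exists>a\<in>A. \<exists>b\<in>B. e = {a, b}) \<and> (\<exists>a\<in>A. \<exists>b\<in>B. f = {a, b})"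

definition spans_alternating_bag ::
  "nat \<Rightarrow> 'a set \<Rightarrow> 'a set set \<Rightarrow> 'a set set \<Rightarrow> 'a set \<Rightarrow> 'a set \<Rightarrow> bool" where
  "spans_alternating_bag l V E1 E2 A B \<longleftrightarrow> (\<exists>e f. alternating_bag l V E1 E2 A B e f)"

end

theory Submission
  imports Defs "HOL-Combinatorics.Transposition"
begin

text \<open>Extend the family of copies by the leftover vertices: colour \<^term>\<open>V\<close> with classes of size
  at most \<^term>\<open>l\<close>, all but possibly one of size exactly \<^term>\<open>l\<close>, and improve the colouring by
  exchanging the colours of two vertices \<^term>\<open>a\<close> and \<^term>\<open>b\<close>. For given \<^term>\<open>a\<close>, all but at
  most $(2l-1)k + l(2l-1)\Delta_2^2 + l < m$ choices of \<^term>\<open>b\<close>, where $k$ bounds the number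
  of blue non-neighbours of a vertex, make \<^term>\<open>a\<close> and \<^term>\<open>b\<close> completely blue to their new
  classes and create no new pair of disjoint red edges between two classes. Minimising first the
  number of blue non-edges inside classes, and then the number of such red pairs, drives both
  to zero.\<close>

section \<open>Neighbour counts and degree bounds\<close>

lemma card_UN_bound:
  assumes "finite I" "card I \<le> n" "\<And>i. i \<in> I \<Longrightarrow> card (S i) \<le> c"
  shows "card (\<Union>i\<in>I. S i) \<le> n * c"
proof -
  have "card (\<Union>i\<in>I. S i) \<le> (\<Sum>i\<in>I. card (S i))"
    using assms(1) by (rule card_UN_le)
  also have "\<dots> \<le> card I * c"
    using sum_bounded_above[of I "\<lambda>i. card (S i)" c] assms(3) by simp
  also have "\<dots> \<le> n * c"
    using assms(2) by simp
  finally show ?thesis .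
qed

lemma vertex_degree_eq:
  assumes "fin_graph V E" "v \<in> V"
  shows "vertex_degree E v = card {u \<in> V. {u, v} \<in> E}"
proof -
  have sub: "E \<subseteq> [V]\<^bsup>2\<^esup>"
    using assms by (simp add: fin_graph_def)
  have "bij_betw (\<lambda>u. {u, v}) {u \<in> V. {u, v} \<in> E} {e \<in> E. v \<in> e}"
  proof (intro bij_betwI')
    fix e assume e: "e \<in> {e \<in> E. v \<in> e}"
    then have "e \<subseteq> V" "card e = 2"
      using sub by (auto simp: nsets_def)
    with e obtain u where "e = {u, v}"
      by (auto simp: card_2_iff)
    with e \<open>e \<subseteq> V\<close> show "\<exists>u\<in>{u \<in> V. {u, v} \<in> E}. e = {u, v}" by auto
  qed (auto simp: doubleton_eq_iff)
  then show ?thesis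
    by (simp add: vertex_degree_def bij_betw_same_card)
qed

lemma max_degree_ge:
  assumes "fin_graph V E" "v \<in> V"
  shows "card {u \<in> V. {u, v} \<in> E} \<le> max_degree V E"
  using assms by (auto simp: max_degree_def fin_graph_def simp flip: vertex_degree_eq[OF assms])

text \<open>A graph has no loops, so \<open>v\<close> counts as its own non-neighbour; hence the
  bound is the full \<open>card V - min_degree V E\<close>, without a further
  \<open>- 1\<close>.\<close>

lemma min_degree_le:
  assumes "fin_graph V E" "v \<in> V"
  shows "card {u \<in> V. {u, v} \<notin> E} \<le> card V - min_degree V E"
proof -
  have fin: "finite V"
    using assms by (simp add: fin_graph_def)
  have "{u \<in> V. {u, v} \<notin> E} = V - {u \<in> V. {u, v} \<in> E}" by auto
  then have "card {u \<in> V. {u, v} \<notin> E} = card V - card {u \<in> V. {u, v} \<in> E}"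
    using fin by (simp add: card_Diff_subset)
  moreover have "min_degree V E \<le> card {u \<in> V. {u, v} \<in> E}"
    using assms fin by (auto simp: min_degree_def simp flip: vertex_degree_eq[OF assms])
  ultimately show ?thesis by simp
qed

section \<open>Colour classes and equitable colourings\<close>

abbreviation colour_class :: "'a set \<Rightarrow> ('a \<Rightarrow> nat) \<Rightarrow> nat \<Rightarrow> 'a set" where
  "colour_class V g i \<equiv> {v \<in> V. g v = i}"

text \<open>Number the vertices from 0 and give each block of \<open>l\<close> consecutive numbers
  one colour. Colours below \<open>card V div l\<close> get full blocks, and the next colour gets
  the remainder.\<close>

lemma equitable_colouring_exists:
  assumes "finite V" "0 < l"
  obtains g :: "'a \<Rightarrow> nat" where
    "\<And>i. card (colour_class V g i) \<le> l"
    "\<And>i. i < card V div l \<Longrightarrow> card (colour_class V g i) = l"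
proof -
  from ex_bij_betw_finite_nat[OF \<open>finite V\<close>]
  obtain h where h: "bij_betw h V {0..<card V}" by blast
  define g where "g = (\<lambda>v. h v div l)"
  have div: "n div l = i \<longleftrightarrow> n \<in> {i * l..<i * l + l}" for n i
    using \<open>0 < l\<close> less_eq_div_iff_mult_less_eq[of l i n] div_less_iff_less_mult[of l n "Suc i"]
    by auto
  have card: "card (colour_class V g i) = card ({0..<card V} \<inter> {i * l..<i * l + l})" for i
  proof -
    have "h ` colour_class V g i = {0..<card V} \<inter> {i * l..<i * l + l}"
    proof -
      have "h ` colour_class V g i = h ` V \<inter> {i * l..<i * l + l}"
        by (auto simp: g_def div)
      then show ?thesis
        using h by (simp add: bij_betw_def)
    qed
    then show ?thesis
      using h by (metis (no_types, lifting) bij_betw_def card_image inj_on_subset mem_Collect_eq subsetI)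
  qed
  show thesis
  proof
    fix i
    show "card (colour_class V g i) \<le> l"
      unfolding card using card_mono[of "{i * l..<i * l + l}"] by fastforce
    assume "i < card V div l"
    then have "(i + 1) * l \<le> card V div l * l"
      by (intro mult_right_mono) auto
    also have "\<dots> \<le> card V" by simp
    finally have "{0..<card V} \<inter> {i * l..<i * l + l} = {i * l..<i * l + l}" by auto
    then show "card (colour_class V g i) = l"
      unfolding card by simp
  qed
qed

lemma card_colour_class_transpose:
  assumes "a \<in> V" "b \<in> V"
  shows "card (colour_class V (g \<circ> transpose a b) i) = card (colour_class V g i)"
proof -
  have V: "transpose a b v \<in> V" if "v \<in> V" for v
    using that assms by (auto simp: transpose_def)
  have "bij_betw (transpose a b) (colour_class V (g \<circ> transpose a b) i) (colour_class V g i)"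
    by (rule bij_betw_byWitness[where f' = "transpose a b"]) (auto simp: V)
  then show ?thesis
    by (rule bij_betw_same_card)
qed

section \<open>Missing blue edges and crossing red pairs\<close>

text \<open>Ordered pairs make each missing edge appear once for either endpoint, so a swap that
  moves \<open>a\<close> visibly removes pairs with first entry \<open>a\<close>.\<close>

definition nonedges :: "'a set \<Rightarrow> 'a set set \<Rightarrow> ('a \<Rightarrow> nat) \<Rightarrow> ('a \<times> 'a) set" where
  "nonedges V E g = {(u, v). u \<in> V \<and> v \<in> V \<and> u \<noteq> v \<and> g u = g v \<and> {u, v} \<notin> E}"

text \<open>The red part of a bag between two colour classes: \<open>x\<close>, \<open>x'\<close>
  lie in one class and \<open>y\<close>, \<open>y'\<close> in another. The remaining inequalities
  for disjoint edges, \<open>x \<noteq> y'\<close> and \<open>y \<noteq> x'\<close>, follow from the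
  colours.\<close>

definition crossing :: "'a set \<Rightarrow> 'a set set \<Rightarrow> ('a \<Rightarrow> nat) \<Rightarrow> 'a \<Rightarrow> 'a \<Rightarrow> 'a \<Rightarrow> 'a \<Rightarrow> bool" where
  "crossing V E g x y x' y' \<longleftrightarrow> {x, y, x', y'} \<subseteq> V \<and> {x, y} \<in> E \<and> {x', y'} \<in> E \<and>
     x \<noteq> x' \<and> y \<noteq> y' \<and> g x = g x' \<and> g y = g y' \<and> g x \<noteq> g y"

text \<open>Unordered edges are essential: after swapping \<^term>\<open>a\<close> and \<^term>\<open>b\<close>, a crossing
  pair using the edge \<^term>\<open>{a, b}\<close> is still crossing, but with its endpoints distributed
  differently.\<close>

definition crossing_pairs :: "'a set \<Rightarrow> 'a set set \<Rightarrow> ('a \<Rightarrow> nat) \<Rightarrow> ('a set \<times> 'a set) set" where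
  "crossing_pairs V E g = {({x, y}, {x', y'}) | x y x' y'. crossing V E g x y x' y'}"

lemma crossing_sym: "crossing V E g x y x' y' \<longleftrightarrow> crossing V E g y x y' x'"
  by (auto simp: crossing_def insert_commute)

lemma crossing_commute: "crossing V E g x y x' y' \<longleftrightarrow> crossing V E g x' y' x y"
  by (auto simp: crossing_def)

lemma crossing_pairsI:
  "crossing V E g x y x' y' \<Longrightarrow> ({x, y}, {x', y'}) \<in> crossing_pairs V E g"
  by (auto simp: crossing_pairs_def)

lemma crossing_pairs_commute:
  assumes "(e, f) \<in> crossing_pairs V E g"
  shows "(f, e) \<in> crossing_pairs V E g"
proof -
  obtain x y x' y' where "e = {x, y}" "f = {x', y'}" "crossing V E g x y x' y'"
    using assms by (auto simp: crossing_pairs_def)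
  then show ?thesis
    using crossing_commute[of V E g x y x' y'] by (simp add: crossing_pairsI)
qed

lemma finite_nonedges: "finite V \<Longrightarrow> finite (nonedges V E g)"
  by (rule finite_subset[of _ "V \<times> V"]) (auto simp: nonedges_def)

lemma finite_crossing_pairs: "finite V \<Longrightarrow> finite (crossing_pairs V E g)"
  by (rule finite_subset[of _ "Pow V \<times> Pow V"]) (auto simp: crossing_pairs_def crossing_def)

text \<open>The last two conditions say that exchanging \<^term>\<open>a\<close> and \<^term>\<open>b\<close> creates no
  alternating bag with a third colour class.\<close>

definition good_swap ::
  "'a set \<Rightarrow> 'a set set \<Rightarrow> 'a set set \<Rightarrow> ('a \<Rightarrow> nat) \<Rightarrow> 'a \<Rightarrow> 'a \<Rightarrow> bool" where
  "good_swap V E1 E2 g a b \<longleftrightarrow> a \<in> V \<and> b \<in> V \<and> g a \<noteq> g b \<and>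
     (\<forall>x\<in>V. g x = g a \<longrightarrow> x \<noteq> a \<longrightarrow> {x, b} \<in> E1) \<and>
     (\<forall>y\<in>V. g y = g b \<longrightarrow> y \<noteq> b \<longrightarrow> {y, a} \<in> E1) \<and>
     (\<forall>x\<in>V. \<forall>c\<in>V. \<forall>d\<in>V. g x = g a \<longrightarrow> x \<noteq> a \<longrightarrow> g c = g d \<longrightarrow> {x, c} \<in> E2 \<longrightarrow> {d, b} \<notin> E2) \<and>
     (\<forall>y\<in>V. \<forall>c\<in>V. \<forall>d\<in>V. g y = g b \<longrightarrow> g c = g d \<longrightarrow> {a, c} \<in> E2 \<longrightarrow> {d, y} \<notin> E2)"

section \<open>Effect of a good swap on both potentials\<close>

text \<open>After the swap \<open>a\<close> and \<open>b\<close> are blue to all of their new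
  classes, so no missing edge meets them; other vertices keep their colours. Recording the loss at
  \<open>a\<close> suffices for a strict decrease.\<close>

lemma nonedges_swap:
  assumes "good_swap V E1 E2 g a b"
  shows "nonedges V E1 (g \<circ> transpose a b) \<subseteq> nonedges V E1 g - {a} \<times> UNIV"
proof -
  let ?g' = "g \<circ> transpose a b"
  have endpoint: "{x, y} \<in> E1" if "x \<in> {a, b}" "y \<in> V" "x \<noteq> y" "?g' x = ?g' y" for x y
  proof (cases "x = a")
    case True
    then have "y \<noteq> b" "g y = g b"
      using that assms by (auto simp: transpose_def good_swap_def split: if_splits)
    with True that show ?thesis
      using assms unfolding good_swap_def by (metis insert_commute)
  next
    case False
    with that have "x = b" by simp
    then have "y \<noteq> a" "g y = g a"
      using that assms by (auto simp: transpose_def good_swap_def split: if_splits)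
    with \<open>x = b\<close> that show ?thesis
      using assms unfolding good_swap_def by (metis insert_commute)
  qed
  have "(x, y) \<in> nonedges V E1 g - {a} \<times> UNIV" if xy: "(x, y) \<in> nonedges V E1 ?g'" for x y
  proof -
    have "x \<in> V" "y \<in> V" "x \<noteq> y" "?g' x = ?g' y" "{x, y} \<notin> E1"
      using xy by (auto simp: nonedges_def)
    moreover from this have "x \<notin> {a, b}" "y \<notin> {a, b}"
      using endpoint[of x y] endpoint[of y x] by (auto simp: insert_commute)
    ultimately show ?thesis
      by (simp add: nonedges_def)
  qed
  then show ?thesis by (simp add: subrelI)
qed

text \<open>If \<open>x\<close> were the only swapped vertex, the pair would violate a red condition
  of \<open>good_swap\<close>; if \<open>y'\<close> were the other one, the red edge
  \<open>{x, y}\<close> would lie inside an old blue class. So \<open>{x, y} = {a, b}\<close>, and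
  the same two edges already crossed before the swap, with \<open>x'\<close> and \<open>y'\<close>
  in exchanged roles.\<close>

lemma crossing_swap_endpoint:
  assumes swap: "good_swap V E1 E2 g a b" and blue: "nonedges V E1 g = {}"
    and disj: "E1 \<inter> E2 = {}"
    and cross: "crossing V E2 (g \<circ> transpose a b) x y x' y'" and x: "x \<in> {a, b}"
  shows "({x, y}, {x', y'}) \<in> crossing_pairs V E2 g"
proof -
  have blueD: "{u, v} \<notin> E2" if "u \<in> V" "v \<in> V" "u \<noteq> v" "g u = g v" for u v
    using that blue disj by (auto simp: nonedges_def)
  have "{a, b} \<subseteq> V" "g a \<noteq> g b"
    and redA: "\<And>u c d. u \<in> V \<Longrightarrow> c \<in> V \<Longrightarrow> d \<in> V \<Longrightarrow> g u = g a \<Longrightarrow> u \<noteq> a \<Longrightarrow> g c = g d \<Longrightarrow>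
      {u, c} \<in> E2 \<Longrightarrow> {d, b} \<notin> E2"
    and redB: "\<And>u c d. u \<in> V \<Longrightarrow> c \<in> V \<Longrightarrow> d \<in> V \<Longrightarrow> g u = g b \<Longrightarrow> g c = g d \<Longrightarrow>
      {a, c} \<in> E2 \<Longrightarrow> {d, u} \<notin> E2"
    using swap unfolding good_swap_def by blast+
  let ?g' = "g \<circ> transpose a b"
  have g': "?g' a = g b" "?g' b = g a" "\<And>u. u \<notin> {a, b} \<Longrightarrow> ?g' u = g u"
    by (auto simp: transpose_def)
  have V: "x \<in> V" "y \<in> V" "x' \<in> V" "y' \<in> V"
    and red: "{x, y} \<in> E2" "{x', y'} \<in> E2"
    and neq: "x \<noteq> x'" "y \<noteq> y'"
    and col: "?g' x = ?g' x'" "?g' y = ?g' y'" "?g' x \<noteq> ?g' y"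
    using cross by (simp_all add: crossing_def)
  have "x' \<notin> {a, b}"
    using x neq(1) col(1) g'(1,2) \<open>g a \<noteq> g b\<close> by (metis empty_iff insertE)
  have y: "y \<noteq> x" "y' \<noteq> x"
    using col by metis+
  have "y \<in> {a, b}"
  proof (rule ccontr)
    assume "y \<notin> {a, b}"
    show False
    proof (cases "y' \<in> {a, b}")
      case True
      then have "g x = g y"
        using x y col g' \<open>y \<notin> {a, b}\<close> by (metis empty_iff insertE)
      then show False
        using blueD V red y by metis
    next
      case False
      then have "g y = g y'"
        using col g' \<open>y \<notin> {a, b}\<close> by metis
      have "g x' = ?g' x"
        using col(1) g'(3)[OF \<open>x' \<notin> {a, b}\<close>] by simp
      have "{y', x'} \<in> E2" "{y, x} \<in> E2"
        using red by (simp_all add: insert_commute)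
      \<comment> \<open>The vertices \<open>y\<close> and \<open>y'\<close> share an old class. For
        \<open>x = a\<close> the red edges \<open>{a, y}\<close> and \<open>{y', x'}\<close>
        contradict \<open>redB\<close>; for \<open>x = b\<close> the red edges
        \<open>{x', y'}\<close> and \<open>{y, b}\<close> contradict \<open>redA\<close>.\<close>
      show False
      proof (cases "x = a")
        case True
        then have "g x' = g b"
          using \<open>g x' = ?g' x\<close> g'(1) by simp
        then show False
          using redB[OF V(3,2,4) _ \<open>g y = g y'\<close>] red(1) \<open>{y', x'} \<in> E2\<close> True by blast
      next
        case False
        with x have "x = b" by simp
        then have "g x' = g a"
          using \<open>g x' = ?g' x\<close> g'(2) by simp
        then show False
          using redA[OF V(3,4,2) _ _ \<open>g y = g y'\<close>[symmetric]] red(2) \<open>{y, x} \<in> E2\<close>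
            \<open>x = b\<close> \<open>x' \<notin> {a, b}\<close> by blast
      qed
    qed
  qed
  then have "y' \<notin> {a, b}"
    using x y neq by auto
  have "crossing V E2 g x y y' x'"
  proof -
    have "g x = g y' \<and> g y = g x' \<and> g x \<noteq> g y"
    proof (cases "x = a")
      case True
      then have "y = b" using \<open>y \<in> {a, b}\<close> y by simp
      then show ?thesis
        using True col g'(1,2) g'(3)[OF \<open>x' \<notin> {a, b}\<close>] g'(3)[OF \<open>y' \<notin> {a, b}\<close>] by simp
    next
      case False
      then have "x = b" "y = a" using x \<open>y \<in> {a, b}\<close> y by auto
      then show ?thesis
        using col g'(1,2) g'(3)[OF \<open>x' \<notin> {a, b}\<close>] g'(3)[OF \<open>y' \<notin> {a, b}\<close>] by simp
    qed
    moreover have "x \<noteq> y'" "y \<noteq> x'"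
      using x \<open>y \<in> {a, b}\<close> \<open>x' \<notin> {a, b}\<close> \<open>y' \<notin> {a, b}\<close> by auto
    ultimately show ?thesis
      using V red by (simp add: crossing_def insert_commute[of y' x'])
  qed
  then show ?thesis
    using crossing_pairsI[of V E2 g x y y' x'] by (simp add: insert_commute[of y' x'])
qed

text \<open>Exchanging the two classes or the two edges moves any swapped vertex to the first
  position, where \<open>crossing_swap_endpoint\<close> applies. A pair that avoids \<open>a\<close>
  and \<open>b\<close> keeps its colours.\<close>

lemma crossing_pairs_swap:
  assumes swap: "good_swap V E1 E2 g a b" and blue: "nonedges V E1 g = {}"
    and disj: "E1 \<inter> E2 = {}"
  shows "crossing_pairs V E2 (g \<circ> transpose a b) \<subseteq> crossing_pairs V E2 g"
proof -
  let ?g' = "g \<circ> transpose a b"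
  note endpoint = crossing_swap_endpoint[OF swap blue disj]
  have "({x, y}, {x', y'}) \<in> crossing_pairs V E2 g" if cross: "crossing V E2 ?g' x y x' y'" for x y x' y'
  proof -
    consider "x \<in> {a, b}" | "y \<in> {a, b}" | "x' \<in> {a, b}" | "y' \<in> {a, b}"
      | "{x, y, x', y'} \<inter> {a, b} = {}" by auto
    then show ?thesis
    proof cases
      case 1
      then show ?thesis using endpoint cross by blast
    next
      case 2
      then show ?thesis
        using endpoint[of y x y' x'] cross crossing_sym[of V E2 ?g' x y x' y']
        by (simp add: insert_commute[of y x] insert_commute[of y' x'])
    next
      case 3
      then show ?thesis
        using endpoint[of x' y' x y] cross crossing_commute[of V E2 ?g' x y x' y']
        by (auto intro: crossing_pairs_commute)
    next
      case 4
      then show ?thesis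
        using endpoint[of y' x' y x] cross crossing_sym[of V E2 ?g' x y x' y']
          crossing_commute[of V E2 ?g' y x y' x']
        by (auto intro: crossing_pairs_commute simp: insert_commute[of y x] insert_commute[of y' x'])
    next
      case 5
      then have "crossing V E2 g x y x' y'"
        using cross by (auto simp: crossing_def)
      then show ?thesis by (rule crossing_pairsI)
    qed
  qed
  then show ?thesis by (auto simp: crossing_pairs_def)
qed

text \<open>The swap moves \<open>a\<close> to another class but fixes \<open>c\<close>,
  \<open>a'\<close> and \<open>c'\<close>, so the two edges no longer join the same two classes. The
  condition \<open>g b \<noteq> g c\<close> excludes in particular \<open>b = c\<close>, where the
  pair would survive with its roles exchanged.\<close>

lemma crossing_pair_destroyed:
  assumes swap: "good_swap V E1 E2 g a b" and cross: "crossing V E2 g a c a' c'"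
    and "g b \<noteq> g c"
  shows "({a, c}, {a', c'}) \<notin> crossing_pairs V E2 (g \<circ> transpose a b)"
proof
  let ?g' = "g \<circ> transpose a b"
  assume "({a, c}, {a', c'}) \<in> crossing_pairs V E2 ?g'"
  then obtain x y x' y' where eq: "{a, c} = {x, y}" "{a', c'} = {x', y'}"
    and "crossing V E2 ?g' x y x' y'"
    unfolding crossing_pairs_def by blast
  \<comment> \<open>The endpoints may be listed in either order, so the sets of colours on the two
    edges are compared; these do not depend on the order.\<close>
  then have "?g' ` {x, y} = ?g' ` {x', y'}"
    by (simp add: crossing_def)
  then have "?g' ` {a, c} = ?g' ` {a', c'}"
    by (simp only: eq)
  moreover have "g a \<noteq> g b"
    using swap by (simp add: good_swap_def)
  moreover have col: "g a' = g a" "g c' = g c" "g c \<noteq> g a" and "a \<noteq> a'"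
    using cross by (simp_all add: crossing_def)
  moreover have "a' \<notin> {a, b}" "c \<notin> {a, b}" "c' \<notin> {a, b}"
    using col \<open>a \<noteq> a'\<close> \<open>g a \<noteq> g b\<close> \<open>g b \<noteq> g c\<close> by fastforce+
  ultimately have "{g b, g c} = {g a, g c}"
    by (simp add: transpose_def)
  then show False
    using \<open>g a \<noteq> g b\<close> \<open>g b \<noteq> g c\<close> by (simp add: doubleton_eq_iff)
qed

section \<open>Existence of good swaps and descent to an extremal colouring\<close>

text \<open>Each requirement excludes \<open>b\<close> from a set of bounded size, and by
  \<open>room\<close> these sets cannot cover \<open>V\<close>. Avoiding the class of
  \<open>c\<close> as well costs at most \<open>l\<close> and is what later destroys a chosen
  crossing pair.\<close>

lemma good_swap_exists:
  assumes fin: "finite V" and loops: "\<And>v. {v} \<notin> E1"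
    and small: "\<And>i. card (colour_class V g i) \<le> l"
    and blue: "\<And>v. v \<in> V \<Longrightarrow> card {u \<in> V. {u, v} \<notin> E1} \<le> k"
    and red: "\<And>v. v \<in> V \<Longrightarrow> card {u \<in> V. {u, v} \<in> E2} \<le> D"
    and room: "(2 * l - 1) * k + l * (2 * l - 1) * D\<^sup>2 + l < card V"
    and a: "a \<in> V"
  obtains b where "good_swap V E1 E2 g a b" "g b \<noteq> g c"
proof -
  define N where "N = (\<lambda>v. {u \<in> V. {u, v} \<notin> E1})"
  define R where "R = (\<lambda>v. {u \<in> V. {u, v} \<in> E2})"
  \<comment> \<open>\<open>W v\<close> is what can be reached from \<open>v\<close> by a red edge, a
    possibly trivial move inside a colour class, and another red edge.\<close>
  define W where "W = (\<lambda>v. \<Union>c\<in>R v. \<Union>d\<in>colour_class V g (g c). R d)"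
  let ?A = "colour_class V g (g a) - {a}"
  let ?cl = "\<lambda>v. colour_class V g (g v)"
  have fin': "finite (N v)" "finite (R v)" "finite (W v)" for v
    using fin by (auto simp: N_def R_def W_def)
  have cardA: "card ?A \<le> l - 1"
    using small[of "g a"] a fin by simp
  have "card (?cl a) > 0"
    using a fin by (auto simp: card_gt_0_iff)
  with small[of "g a"] have "l > 0" by linarith
  have cardW: "card (W v) \<le> D * (l * D)" if "v \<in> V" for v
    unfolding W_def
    using that fin fin' small red by (intro card_UN_bound) (auto simp: R_def)
  have 1: "card (\<Union>x\<in>?A. N x) \<le> (l - 1) * k"
    using cardA fin blue by (intro card_UN_bound) (auto simp: N_def)
  have 2: "card (\<Union>y\<in>N a. ?cl y) \<le> k * l"
    using fin' small blue a by (intro card_UN_bound) (auto simp: N_def)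
  have 3: "card (\<Union>x\<in>?A. W x) \<le> (l - 1) * (D * (l * D))"
    using cardA fin cardW by (intro card_UN_bound) auto
  have 4: "card (\<Union>y\<in>W a. ?cl y) \<le> D * (l * D) * l"
    using fin' small cardW a by (intro card_UN_bound) auto
  \<comment> \<open>In order: \<open>b\<close> not blue to the rest of the class of
    \<open>a\<close>, \<open>a\<close> not blue to the class of \<open>b\<close>, the two red
    conditions, and the class of \<open>c\<close>.\<close>
  let ?bad = "(\<Union>x\<in>?A. N x) \<union> (\<Union>y\<in>N a. ?cl y) \<union> (\<Union>x\<in>?A. W x) \<union> (\<Union>y\<in>W a. ?cl y) \<union> ?cl c"
  have "card ?bad \<le> (l - 1) * k + k * l + (l - 1) * (D * (l * D)) + D * (l * D) * l + l"
    by (intro card_Un_le[THEN order_trans] add_mono 1 2 3 4 small)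
  also have "\<dots> = (2 * l - 1) * k + l * (2 * l - 1) * D\<^sup>2 + l"
    using \<open>l > 0\<close> by (cases l) (auto simp: algebra_simps power2_eq_square)
  also have "\<dots> < card V" by (rule room)
  finally have "card ?bad < card V" .
  moreover have "finite ?bad"
    using fin fin' by simp
  ultimately have "\<not> V \<subseteq> ?bad"
    using card_mono[of ?bad V] by linarith
  then obtain b where b: "b \<in> V" "b \<notin> ?bad" by blast
  \<comment> \<open>This puts the class of \<open>a\<close> itself among the classes excluded
    through \<open>N a\<close>, which gives \<open>g a \<noteq> g b\<close>.\<close>
  have "a \<in> N a"
    using a loops by (simp add: N_def)
  have "good_swap V E1 E2 g a b"
    unfolding good_swap_def
  proof (intro conjI ballI impI)
    show "g a \<noteq> g b"
      using b \<open>a \<in> N a\<close> by fastforce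
    show "{x, b} \<in> E1" if "x \<in> V" "g x = g a" "x \<noteq> a" for x
    proof -
      have "b \<notin> N x" using b(2) that by blast
      then show ?thesis using b(1) by (simp add: N_def insert_commute[of b x])
    qed
    show "{y, a} \<in> E1" if "y \<in> V" "g y = g b" for y
    proof -
      have "y \<notin> N a" using b that by fastforce
      then show ?thesis using that by (simp add: N_def)
    qed
    show "{d, b} \<notin> E2" if "x \<in> V" "c \<in> V" "d \<in> V" "g x = g a" "x \<noteq> a" "g c = g d" "{x, c} \<in> E2"
      for x c d
    proof
      assume "{d, b} \<in> E2"
      with b(1) that have "c \<in> R x" "d \<in> ?cl c" "b \<in> R d"
        by (simp_all add: R_def insert_commute)
      then have "b \<in> W x"
        unfolding W_def by blast
      then show False using b(2) that by blast
    qed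
    show "{d, y} \<notin> E2" if "y \<in> V" "c \<in> V" "d \<in> V" "g y = g b" "g c = g d" "{a, c} \<in> E2" for y c d
    proof
      assume "{d, y} \<in> E2"
      with that have "c \<in> R a" "d \<in> ?cl c" "y \<in> R d"
        by (simp_all add: R_def insert_commute)
      then have "y \<in> W a"
        unfolding W_def by blast
      then show False using b that by fastforce
    qed
  qed (use a b in auto)
  moreover have "g b \<noteq> g c" using b by auto
  ultimately show thesis by (rule that)
qed

text \<open>The order of the minimisations matters: \<open>crossing_pairs_swap\<close> presupposes
  blue classes. Good swaps preserve this, so the second descent stays among colourings without
  missing edges.\<close>

lemma crossing_free_colouring_exists:
  assumes fin: "finite V" and loops: "\<And>v. {v} \<notin> E1" and disj: "E1 \<inter> E2 = {}"
    and "0 < l"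
    and blue: "\<And>v. v \<in> V \<Longrightarrow> card {u \<in> V. {u, v} \<notin> E1} \<le> k"
    and red: "\<And>v. v \<in> V \<Longrightarrow> card {u \<in> V. {u, v} \<in> E2} \<le> D"
    and room: "(2 * l - 1) * k + l * (2 * l - 1) * D\<^sup>2 + l < card V"
  obtains g where "\<And>i. i < card V div l \<Longrightarrow> card (colour_class V g i) = l"
    "nonedges V E1 g = {}" "crossing_pairs V E2 g = {}"
proof -
  \<comment> \<open>The upper bound also covers the class of leftover vertices, which takes part in
    the swaps and in the count of bad choices.\<close>
  define equitable where "equitable = (\<lambda>g. (\<forall>i. card (colour_class V g i) \<le> l) \<and>
    (\<forall>i < card V div l. card (colour_class V g i) = l))"
  have equitable_swap: "equitable (g \<circ> transpose a b)" if "equitable g" "good_swap V E1 E2 g a b" for g a b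
  proof -
    have "a \<in> V" "b \<in> V"
      using that(2) by (simp_all add: good_swap_def)
    then show ?thesis
      using that(1)
      unfolding equitable_def card_colour_class_transpose[OF \<open>a \<in> V\<close> \<open>b \<in> V\<close>] by blast
  qed
  have swap_exists: "\<exists>b. good_swap V E1 E2 g a b \<and> g b \<noteq> g c" if "equitable g" "a \<in> V" for g a c
  proof -
    have "\<And>i. card (colour_class V g i) \<le> l"
      using that by (simp add: equitable_def)
    from good_swap_exists[OF fin loops this blue red room \<open>a \<in> V\<close>] show ?thesis by blast
  qed
  obtain g0 where "equitable g0"
    using equitable_colouring_exists[OF fin \<open>0 < l\<close>] by (metis equitable_def)
  then obtain g1 where g1: "equitable g1"
    and min1: "\<And>g. equitable g \<Longrightarrow> card (nonedges V E1 g1) \<le> card (nonedges V E1 g)"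
    using ex_has_least_nat[of equitable g0 "\<lambda>g. card (nonedges V E1 g)"] by blast
  have "nonedges V E1 g1 = {}"
  proof (rule ccontr)
    assume "nonedges V E1 g1 \<noteq> {}"
    then obtain a u where au: "(a, u) \<in> nonedges V E1 g1" by auto
    then have "a \<in> V" by (simp add: nonedges_def)
    then obtain b where b: "good_swap V E1 E2 g1 a b"
      using swap_exists g1 by blast
    have "nonedges V E1 (g1 \<circ> transpose a b) \<subset> nonedges V E1 g1"
      using nonedges_swap[OF b] au by blast
    then have "card (nonedges V E1 (g1 \<circ> transpose a b)) < card (nonedges V E1 g1)"
      using fin by (intro psubset_card_mono finite_nonedges)
    with min1[OF equitable_swap[OF g1 b]] show False by simp
  qed
  with g1 obtain g where g: "equitable g" "nonedges V E1 g = {}"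
    and min: "\<And>h. equitable h \<Longrightarrow> nonedges V E1 h = {} \<Longrightarrow>
      card (crossing_pairs V E2 g) \<le> card (crossing_pairs V E2 h)"
    using ex_has_least_nat[of "\<lambda>g. equitable g \<and> nonedges V E1 g = {}" g1
        "\<lambda>g. card (crossing_pairs V E2 g)"] by blast
  have "crossing_pairs V E2 g = {}"
  proof (rule ccontr)
    assume "crossing_pairs V E2 g \<noteq> {}"
    then obtain a c a' c' where cross: "crossing V E2 g a c a' c'"
      unfolding crossing_pairs_def by blast
    then have "a \<in> V" by (simp add: crossing_def)
    then obtain b where b: "good_swap V E1 E2 g a b" "g b \<noteq> g c"
      using swap_exists g by blast
    have "crossing_pairs V E2 (g \<circ> transpose a b) \<subset> crossing_pairs V E2 g"
      using crossing_pairs_swap[OF b(1) g(2) disj] crossing_pair_destroyed[OF b(1) cross b(2)]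
        crossing_pairsI[OF cross] by blast
    then have "card (crossing_pairs V E2 (g \<circ> transpose a b)) < card (crossing_pairs V E2 g)"
      using fin by (intro psubset_card_mono finite_crossing_pairs)
    moreover have "nonedges V E1 (g \<circ> transpose a b) = {}"
      using nonedges_swap[OF b(1)] g(2) by blast
    ultimately show False
      using min[OF equitable_swap[OF g(1) b(1)]] by simp
  qed
  with g show thesis
    using that[of g] by (simp add: equitable_def)
qed

section \<open>Numerical estimate and passage from colourings to copies\<close>

text \<open>With \<open>s\<close> for \<open>m / l^2\<close> and \<open>t\<close> for
  \<open>m * \<alpha>\<close>, the hypotheses give \<open>k \<le> s - t\<close> and
  \<open>D^2 \<le> (t - l) / 3\<close>. The estimate becomes linear in \<open>s\<close> and
  \<open>t\<close>, with \<open>0 \<le> t \<le> s\<close> and \<open>m = s * l^2\<close>.\<close>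

lemma room_bound:
  fixes k D l m :: nat and \<alpha> :: real
  assumes "l \<ge> 2" "0 < \<alpha>" "\<alpha> < 1 / (real l)\<^sup>2"
    and k: "real k \<le> real m / (real l)\<^sup>2 - real m * \<alpha>"
    and D: "real D \<le> sqrt ((real m * \<alpha> - real l) / 3)"
  shows "(2 * l - 1) * k + l * (2 * l - 1) * D\<^sup>2 + l < m"
proof -
  define L t s where "L = real l" and "t = real m * \<alpha>" and "s = real m / L\<^sup>2"
  have L: "L \<ge> 2" using \<open>l \<ge> 2\<close> by (simp add: L_def)
  have m: "real m = s * L\<^sup>2" using L by (simp add: s_def)
  \<comment> \<open>The function \<open>sqrt\<close> is odd on the reals, so this forces
    \<open>t \<ge> L\<close>; otherwise squaring would only give the absolute value.\<close>
  have "0 \<le> sqrt ((t - L) / 3)"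
    using order_trans[OF of_nat_0_le_iff D] by (simp only: L_def t_def)
  then have D2: "(real D)\<^sup>2 \<le> (t - L) / 3"
    using D power_mono[of "real D" "sqrt ((t - L) / 3)" 2] by (simp add: L_def t_def)
  have t: "0 \<le> t" "t \<le> s"
    using \<open>0 < \<alpha>\<close> order_trans[OF of_nat_0_le_iff k] by (simp_all add: t_def s_def L_def)
  have "(2 * L - 1) * real k + L * (2 * L - 1) * (real D)\<^sup>2 + L
      \<le> (2 * L - 1) * (s - t) + L * (2 * L - 1) * ((t - L) / 3) + L"
    using k D2 L by (intro add_mono mult_left_mono) (auto simp: s_def t_def L_def)
  \<comment> \<open>The rearrangement rests on \<open>2 * L - 1 = L^2 - (L - 1)^2\<close>. The last
    subtracted term is positive and gives strictness.\<close>
  also have "\<dots> = s * L\<^sup>2 - (s - t) * (L - 1)\<^sup>2 - t * (L\<^sup>2 + L) / 3 - L * (L * (2 * L - 1) / 3 - 1)"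
    by (simp add: field_simps power2_eq_square)
  also have "\<dots> < s * L\<^sup>2"
  proof -
    have "2 * 3 \<le> L * (2 * L - 1)"
      using L by (intro mult_mono) auto
    then have "0 < L * (L * (2 * L - 1) / 3 - 1)"
      using L by (intro mult_pos_pos) auto
    moreover have "0 \<le> (s - t) * (L - 1)\<^sup>2" "0 \<le> t * (L\<^sup>2 + L) / 3"
      using t L by auto
    ultimately show ?thesis by linarith
  qed
  finally have "real ((2 * l - 1) * k + l * (2 * l - 1) * D\<^sup>2 + l) < real m"
    using \<open>l \<ge> 2\<close> by (simp add: m L_def of_nat_diff)
  then show ?thesis by linarith
qed

theorem theorem3:
  fixes l :: nat
  assumes "l \<ge> 2"
  shows "\<exists>m0::nat. \<forall>m\<ge>m0. \<forall>(V::'a set) E1 E2. \<forall>\<alpha>::real.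
    fin_graph V E1 \<longrightarrow> fin_graph V E2 \<longrightarrow> card V = m \<longrightarrow> E1 \<inter> E2 = {} \<longrightarrow>
    0 < \<alpha> \<longrightarrow> \<alpha> < 1 / (real l)\<^sup>2 \<longrightarrow>
    real m * (((real l)\<^sup>2 - 1) / (real l)\<^sup>2 + \<alpha>) \<le> real (min_degree V E1) \<longrightarrow>
    real (max_degree V E2) \<le> sqrt ((real m * \<alpha> - real l) / 3) \<longrightarrow>
    (\<exists>\<C>. (\<forall>A\<in>\<C>. complete_copy l V E1 A) \<and> disjoint \<C> \<and> card \<C> = m div l \<and>
      (\<forall>A\<in>\<C>. \<forall>B\<in>\<C>. A \<noteq> B \<longrightarrow> \<not> spans_alternating_bag l V E1 E2 A B))"
\<comment> \<open>The threshold can be 0 because the hypotheses themselves force \<open>m\<close> to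
  be large: the bound on the maximum degree gives \<open>m * \<alpha> \<ge> l\<close>, and with
  \<open>\<alpha> < 1 / l^2\<close> this yields \<open>m > l^3\<close>.\<close>
proof (intro exI[of _ 0] allI impI)
  fix m and V :: "'a set" and E1 E2 :: "'a set set" and \<alpha> :: real
  assume G1: "fin_graph V E1" and G2: "fin_graph V E2" and m: "card V = m"
    and disj: "E1 \<inter> E2 = {}" and \<alpha>: "0 < \<alpha>" "\<alpha> < 1 / (real l)\<^sup>2"
    and min: "real m * (((real l)\<^sup>2 - 1) / (real l)\<^sup>2 + \<alpha>) \<le> real (min_degree V E1)"
    and max: "real (max_degree V E2) \<le> sqrt ((real m * \<alpha> - real l) / 3)"
  have fin: "finite V" and loops: "{v} \<notin> E1" for v
    using G1 by (auto simp: fin_graph_def nsets_def)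
  have "real m * \<alpha> \<le> real m / (real l)\<^sup>2"
    using \<alpha> mult_left_mono[of \<alpha> "1 / (real l)\<^sup>2" "real m"] by simp
  moreover have "real m * (((real l)\<^sup>2 - 1) / (real l)\<^sup>2 + \<alpha>) = real m - (real m / (real l)\<^sup>2 - real m * \<alpha>)"
    using \<open>l \<ge> 2\<close> by (simp add: field_simps)
  \<comment> \<open>Subtraction on naturals truncates at 0; in that case the bound holds because its
    right-hand side is nonnegative.\<close>
  ultimately have "real (m - min_degree V E1) \<le> real m / (real l)\<^sup>2 - real m * \<alpha>"
    using min by (cases "min_degree V E1 \<le> m") (auto simp: of_nat_diff)
  note room = room_bound[OF \<open>l \<ge> 2\<close> \<alpha> this max]
  have "0 < l" using \<open>l \<ge> 2\<close> by simp
  obtain g where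
    size: "\<And>i. i < m div l \<Longrightarrow> card (colour_class V g i) = l"
    and blue: "nonedges V E1 g = {}" and red: "crossing_pairs V E2 g = {}"
    using crossing_free_colouring_exists[OF fin loops disj \<open>0 < l\<close> min_degree_le[OF G1]
        max_degree_ge[OF G2]] room unfolding m by blast
  \<comment> \<open>Only the full classes are kept; the leftover class is dropped.\<close>
  let ?\<C> = "colour_class V g ` {..<m div l}"
  have nonempty: "colour_class V g i \<noteq> {}" if "i < m div l" for i
    using size[OF that] \<open>l \<ge> 2\<close> by (metis card.empty not_numeral_le_zero)
  have inj: "inj_on (colour_class V g) {..<m div l}"
  proof (rule inj_onI)
    fix i j assume "i \<in> {..<m div l}" "colour_class V g i = colour_class V g j"
    with nonempty[of i] show "i = j" by auto
  qed
  show "\<exists>\<C>. (\<forall>A\<in>\<C>. complete_copy l V E1 A) \<and> disjoint \<C> \<and> card \<C> = m div l \<and>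
      (\<forall>A\<in>\<C>. \<forall>B\<in>\<C>. A \<noteq> B \<longrightarrow> \<not> spans_alternating_bag l V E1 E2 A B)"
  proof (intro exI[of _ ?\<C>] conjI ballI impI)
    fix A assume "A \<in> ?\<C>"
    moreover have "{u, v} \<in> E1" if "u \<in> V" "v \<in> V" "u \<noteq> v" "g u = g v" for u v
      using that blue by (auto simp: nonedges_def)
    ultimately show "complete_copy l V E1 A"
      using size fin by (auto simp: complete_copy_def nsets_def clique_def)
  next
    show "disjoint ?\<C>" by (auto simp: disjoint_def)
    show "card ?\<C> = m div l" using inj by (simp add: card_image)
  next
    fix A B assume "A \<in> ?\<C>" "B \<in> ?\<C>" "A \<noteq> B"
    then obtain i j where ij: "A = colour_class V g i" "B = colour_class V g j" "i \<noteq> j" by blast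
    show "\<not> spans_alternating_bag l V E1 E2 A B"
    proof
      assume "spans_alternating_bag l V E1 E2 A B"
      then obtain x y x' y' where "x \<in> A" "y \<in> B" "x' \<in> A" "y' \<in> B"
        "{x, y} \<in> E2" "{x', y'} \<in> E2" "{x, y} \<inter> {x', y'} = {}"
        unfolding spans_alternating_bag_def alternating_bag_def by blast
      then have "crossing V E2 g x y x' y'"
        using ij by (auto simp: crossing_def)
      from crossing_pairsI[OF this] red show False by simp
    qed
  qed
qed

end
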